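(* Let $F:\mathbf{C}\to\mathbf{D}$ be a (covariant) functor, let $U:\mathbf{D}\to\mathbf{Set}$ be a faithful functor, put $\mathbb{F}=U\circ F:\mathbf{C}\to\mathbf{Set}$, and let $(\mathbb{F},\mathbf{C},\mathbf{Set})$ be the concrete graph of the functor. Let $P:(\mathbb{F},\mathbf{C},\mathbf{Set})\to\mathbf{C}$ be the first projection functor, $P(X,x)=X$ and $P(f,\mathbb{F}f|_x)=f$. Then $P$ is a split opfibration.
   Context: The concrete graph $(\mathbb{F},\mathbf{C},\mathbf{Set})$ is the category whose objects are the pairs $(X,x)$ with $X\in\mathrm{Ob}(\mathbf{C})$ and $x\in\mathbb{F}X=U(FX)$; whose morphisms $(X,x)\to(Y,y)$ are the pairs $(f,\mathbb{F}f|_x)$ where $f:X\to Y$ is a morphism of $\mathbf{C}$ with $y=\mathbb{F}f(x)$, and $\mathbb{F}f|_x$ denotes the restriction of the function $\mathbb{F}f$ to the element $x$; identities are $(\mathrm{id}_X,\mathrm{id}_{\mathbb{F}X}|_x)$ and composition is $(g,\mathbb{F}g|_y)\bullet(f,\mathbb{F}f|_x)=(g\circ f,\mathbb{F}(g\circ f)|_x)$. Let $P:\mathbf{E}\to\mathbf{B}$ be a functor. A morphism $f:X\to Y$ in $\mathbf{E}$ is opCartesian over $u:I\to J$ in $\mathbf{B}$ if $Pf=u$ and for every $g:X\to Z$ in $\mathbf{E}$ and every $w:J\to PZ$ with $Pg=w\circ u$ there is a unique $h:Y\to Z$ in $\mathbf{E}$ with $Ph=w$ and $h\circ f=g$. $P$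 is an opfibration if for every $X\in\mathbf{E}$ and $u:PX\to J$ in $\mathbf{B}$ there is an opCartesian morphism $X\to Y$ over $u$. An opfibration is split if it admits an opcleavage (a choice, for each such $u$ and $X$, of an opCartesian morphism $\kappa(u,X)$ over $u$ with domain $X$) such that $\kappa(\mathrm{id}_{PX},X)=\mathrm{id}_X$ and $\kappa(v,Y)\circ\kappa(u,X)=\kappa(v\circ u,X)$, where $Y$ is the codomain of $\kappa(u,X)$. *)

theory Defs
  imports Main "HOL-Library.FuncSet"
begin

record ('o, 'm) cat_data =
  Ob :: "'o set"
  Arr :: "'m set"
  Dom :: "'m \<Rightarrow> 'o"
  Cod :: "'m \<Rightarrow> 'o"
  Id :: "'o \<Rightarrow> 'm"
  Comp :: "'m \<Rightarrow> 'm \<Rightarrow> 'm"  (infixr "\<cdot>\<index>" 70)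

definition Hom :: "('o, 'm) cat_data \<Rightarrow> 'o \<Rightarrow> 'o \<Rightarrow> 'm set" where
  "Hom C X Y = {f \<in> Arr C. Dom C f = X \<and> Cod C f = Y}"

text \<open>Composition is written in applicative order: \<open>g \<cdot> f\<close> is \<open>g\<close> after \<open>f\<close>.
  The operations are unconstrained outside objects, arrows and composable pairs.\<close>

locale category =
  fixes C :: "('o, 'm) cat_data" (structure)
  assumes Dom_Ob: "f \<in> Arr C \<Longrightarrow> Dom C f \<in> Ob C"
    and Cod_Ob: "f \<in> Arr C \<Longrightarrow> Cod C f \<in> Ob C"
    and Id_Hom: "X \<in> Ob C \<Longrightarrow> Id C X \<in> Hom C X X"
    and Comp_Hom: "\<lbrakk>f \<in> Hom C X Y; g \<in> Hom C Y Z\<rbrakk> \<Longrightarrow> g \<cdot> f \<in> Hom C X Z"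
    and Id_right: "f \<in> Hom C X Y \<Longrightarrow> f \<cdot> Id C X = f"
    and Id_left: "f \<in> Hom C X Y \<Longrightarrow> Id C Y \<cdot> f = f"
    and Comp_assoc: "\<lbrakk>f \<in> Hom C W X; g \<in> Hom C X Y; h \<in> Hom C Y Z\<rbrakk>
      \<Longrightarrow> (h \<cdot> g) \<cdot> f = h \<cdot> (g \<cdot> f)"

record ('o, 'm, 'o2, 'm2) functor_data =
  on_Ob :: "'o \<Rightarrow> 'o2"
  on_Arr :: "'m \<Rightarrow> 'm2"

locale covariant_functor =
  source: category C + target: category D
  for C :: "('o, 'm) cat_data" and D :: "('o2, 'm2) cat_data" +
  fixes F :: "('o, 'm, 'o2, 'm2) functor_data"
  assumes on_Ob_Ob: "X \<in> Ob C \<Longrightarrow> on_Ob F X \<in> Ob D"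
    and on_Arr_Hom: "f \<in> Hom C X Y \<Longrightarrow> on_Arr F f \<in> Hom D (on_Ob F X) (on_Ob F Y)"
    and on_Arr_Id: "X \<in> Ob C \<Longrightarrow> on_Arr F (Id C X) = Id D (on_Ob F X)"
    and on_Arr_Comp: "\<lbrakk>f \<in> Hom C X Y; g \<in> Hom C Y Z\<rbrakk>
      \<Longrightarrow> on_Arr F (g \<cdot>\<^bsub>C\<^esub> f) = on_Arr F g \<cdot>\<^bsub>D\<^esub> on_Arr F f"

locale faithful_functor = covariant_functor C D F
  for C :: "('o, 'm) cat_data" and D :: "('o2, 'm2) cat_data"
    and F :: "('o, 'm, 'o2, 'm2) functor_data" +
  assumes faithful: "\<lbrakk>X \<in> Ob C; Y \<in> Ob C; f \<in> Hom C X Y; g \<in> Hom C X Y;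
    on_Arr F f = on_Arr F g\<rbrakk> \<Longrightarrow> f = g"

definition functor_comp ::
  "('o2, 'm2, 'o3, 'm3) functor_data \<Rightarrow> ('o, 'm, 'o2, 'm2) functor_data
    \<Rightarrow> ('o, 'm, 'o3, 'm3) functor_data"  (infixr "\<circ>\<^sub>F" 55) where
  "G \<circ>\<^sub>F F = \<lparr>on_Ob = on_Ob G \<circ> on_Ob F, on_Arr = on_Arr G \<circ> on_Arr F\<rparr>"

text \<open>The objects are all sets with elements in a type \<open>'u\<close>, which plays the role of the
  universe. An arrow is a function together with its domain and codomain; the underlying HOL
  function is extensional, so that equality of arrows is equality of functions.\<close>

datatype 'u set_arr =
  Set_Arr (src: "'u set") (fn: "'u \<Rightarrow> 'u") (tgt: "'u set")

definition SetCat :: "('u set, 'u set_arr) cat_data" where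
  "SetCat = \<lparr>
    Ob = UNIV,
    Arr = {m. fn m \<in> src m \<rightarrow>\<^sub>E tgt m},
    Dom = src,
    Cod = tgt,
    Id = (\<lambda>A. Set_Arr A (\<lambda>a\<in>A. a) A),
    Comp = (\<lambda>n m. Set_Arr (src m) (\<lambda>a\<in>src m. fn n (fn m a)) (tgt n))\<rparr>"

text \<open>The restriction of a function to an element \<open>x\<close> of its domain is a function on \<open>{x}\<close>.
  It keeps its domain, so it determines \<open>x\<close>.\<close>

definition restrict_elem :: "'u set_arr \<Rightarrow> 'u \<Rightarrow> 'u set_arr"  (infixl "|\<^sub>e" 65) where
  "m |\<^sub>e x = Set_Arr {x} (restrict (fn m) {x}) (tgt m)"

text \<open>An arrow \<open>(f, r)\<close> has the form \<open>(f, on_Arr FF f |\<^sub>e x)\<close>; the element \<open>x\<close> is recovered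
  as the only element of \<open>src r\<close>, and \<open>fn r x\<close> is the value of \<open>on_Arr FF f\<close> at \<open>x\<close>.\<close>

definition concrete_graph ::
  "('o, 'm) cat_data \<Rightarrow> ('o, 'm, 'u set, 'u set_arr) functor_data
    \<Rightarrow> ('o \<times> 'u, 'm \<times> 'u set_arr) cat_data" where
  "concrete_graph C FF = \<lparr>
    Ob = {(X, x). X \<in> Ob C \<and> x \<in> on_Ob FF X},
    Arr = {(f, on_Arr FF f |\<^sub>e x) | f x. f \<in> Arr C \<and> x \<in> on_Ob FF (Dom C f)},
    Dom = (\<lambda>(f, r). (Dom C f, the_elem (src r))),
    Cod = (\<lambda>(f, r). (Cod C f, fn r (the_elem (src r)))),
    Id = (\<lambda>(X, x). (Id C X, Id SetCat (on_Ob FF X) |\<^sub>e x)),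
    Comp = (\<lambda>(g, s) (f, r). (g \<cdot>\<^bsub>C\<^esub> f, on_Arr FF (g \<cdot>\<^bsub>C\<^esub> f) |\<^sub>e the_elem (src r)))\<rparr>"

definition first_proj :: "('o \<times> 'u, 'm \<times> 'u set_arr, 'o, 'm) functor_data" where
  "first_proj = \<lparr>on_Ob = fst, on_Arr = fst\<rparr>"

definition opCartesian ::
  "('eo, 'em) cat_data \<Rightarrow> ('bo, 'bm) cat_data \<Rightarrow> ('eo, 'em, 'bo, 'bm) functor_data
    \<Rightarrow> 'em \<Rightarrow> 'bm \<Rightarrow> bool" where
  "opCartesian E B P f u \<longleftrightarrow>
    f \<in> Arr E \<and> u \<in> Arr B \<and> on_Arr P f = u \<and>
    (\<forall>Z \<in> Ob E. \<forall>g \<in> Hom E (Dom E f) Z. \<forall>w \<in> Hom B (Cod B u) (on_Ob P Z).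
      on_Arr P g = w \<cdot>\<^bsub>B\<^esub> u \<longrightarrow>
      (\<exists>!h. h \<in> Hom E (Cod E f) Z \<and> on_Arr P h = w \<and> h \<cdot>\<^bsub>E\<^esub> f = g))"

definition opfibration ::
  "('eo, 'em) cat_data \<Rightarrow> ('bo, 'bm) cat_data \<Rightarrow> ('eo, 'em, 'bo, 'bm) functor_data \<Rightarrow> bool" where
  "opfibration E B P \<longleftrightarrow>
    covariant_functor E B P \<and>
    (\<forall>X \<in> Ob E. \<forall>u \<in> Arr B. Dom B u = on_Ob P X \<longrightarrow>
      (\<exists>f \<in> Arr E. Dom E f = X \<and> opCartesian E B P f u))"

definition opcleavage ::
  "('eo, 'em) cat_data \<Rightarrow> ('bo, 'bm) cat_data \<Rightarrow> ('eo, 'em, 'bo, 'bm) functor_data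
    \<Rightarrow> ('bm \<Rightarrow> 'eo \<Rightarrow> 'em) \<Rightarrow> bool" where
  "opcleavage E B P \<kappa> \<longleftrightarrow>
    (\<forall>X \<in> Ob E. \<forall>u \<in> Arr B. Dom B u = on_Ob P X \<longrightarrow>
      \<kappa> u X \<in> Arr E \<and> Dom E (\<kappa> u X) = X \<and> opCartesian E B P (\<kappa> u X) u)"

definition split_opcleavage ::
  "('eo, 'em) cat_data \<Rightarrow> ('bo, 'bm) cat_data \<Rightarrow> ('eo, 'em, 'bo, 'bm) functor_data
    \<Rightarrow> ('bm \<Rightarrow> 'eo \<Rightarrow> 'em) \<Rightarrow> bool" where
  "split_opcleavage E B P \<kappa> \<longleftrightarrow>
    opcleavage E B P \<kappa> \<and>
    (\<forall>X \<in> Ob E. \<kappa> (Id B (on_Ob P X)) X = Id E X) \<and>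
    (\<forall>X \<in> Ob E. \<forall>u \<in> Arr B. \<forall>v \<in> Arr B.
      Dom B u = on_Ob P X \<and> Dom B v = Cod B u \<longrightarrow>
      \<kappa> v (Cod E (\<kappa> u X)) \<cdot>\<^bsub>E\<^esub> \<kappa> u X = \<kappa> (v \<cdot>\<^bsub>B\<^esub> u) X)"

definition split_opfibration ::
  "('eo, 'em) cat_data \<Rightarrow> ('bo, 'bm) cat_data \<Rightarrow> ('eo, 'em, 'bo, 'bm) functor_data \<Rightarrow> bool" where
  "split_opfibration E B P \<longleftrightarrow>
    opfibration E B P \<and> (\<exists>\<kappa>. split_opcleavage E B P \<kappa>)"

end

theory Submission
  imports Defs
begin

text \<open>An arrow of the concrete graph is determined by its first component and its source
  element: over \<open>u : X \<rightarrow> J\<close> there is exactly one arrow out of \<open>(X, x)\<close>, namely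
  \<open>(u, \<FF> u |\<^sub>e x)\<close>. So every such arrow is opCartesian, and the cleavage is forced and
  functorial.\<close>

lemma covariant_functor_comp:
  assumes "covariant_functor C D F" and "covariant_functor D E G"
  shows "covariant_functor C E (G \<circ>\<^sub>F F)"
proof -
  interpret F: covariant_functor C D F by fact
  interpret G: covariant_functor D E G by fact
  show ?thesis
    by unfold_locales
      (auto simp: functor_comp_def F.on_Ob_Ob G.on_Ob_Ob F.on_Arr_Hom G.on_Arr_Hom
        F.on_Arr_Id G.on_Arr_Id F.on_Arr_Comp G.on_Arr_Comp[OF F.on_Arr_Hom F.on_Arr_Hom])
qed

text \<open>The concrete graph is built from the composite functor to sets, so the argument is
  carried out for any such \<open>FF\<close> and instantiated with
  \<open>U \<circ>\<^sub>F F\<close> at the end.\<close>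

locale set_valued_functor = covariant_functor C SetCat FF
  for C :: "('o, 'm) cat_data" and FF :: "('o, 'm, 'u set, 'u set_arr) functor_data"
begin

abbreviation E :: "('o \<times> 'u, 'm \<times> 'u set_arr) cat_data" where
  "E \<equiv> concrete_graph C FF"

abbreviation act :: "'m \<Rightarrow> 'u \<Rightarrow> 'u" where
  "act f \<equiv> fn (on_Arr FF f)"

text \<open>Arrows are kept in this form so that the rules below can compute with \<open>f\<close>
  and \<open>x\<close> without unfolding \<open>restrict_elem\<close>.\<close>

definition lift :: "'m \<Rightarrow> 'u \<Rightarrow> 'm \<times> 'u set_arr" where
  "lift f x = (f, on_Arr FF f |\<^sub>e x)"

lemma fst_lift [simp]: "fst (lift f x) = f"
  by (simp add: lift_def)

lemma pair_eq_lift: "(f', r) = lift f x \<longleftrightarrow> f' = f \<and> r = on_Arr FF f |\<^sub>e x"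
  by (simp add: lift_def)

lemma act_in: "f \<in> Hom C X Y \<Longrightarrow> x \<in> on_Ob FF X \<Longrightarrow> act f x \<in> on_Ob FF Y"
  using on_Arr_Hom[of f X Y] by (auto simp: Hom_def SetCat_def)

lemma act_Id: "X \<in> Ob C \<Longrightarrow> x \<in> on_Ob FF X \<Longrightarrow> act (Id C X) x = x"
  by (simp add: on_Arr_Id SetCat_def)

text \<open>Composition in \<open>SetCat\<close> is restricted to the source set; the membership of
  \<open>x\<close> is what lets the restricted function be evaluated.\<close>

lemma act_Comp:
  assumes "f \<in> Hom C X Y" "g \<in> Hom C Y Z" "x \<in> on_Ob FF X"
  shows "act (g \<cdot>\<^bsub>C\<^esub> f) x = act g (act f x)"
  using assms on_Arr_Hom[of f X Y] by (auto simp: on_Arr_Comp SetCat_def Hom_def)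

lemma Ob_E: "(X, x) \<in> Ob E \<longleftrightarrow> X \<in> Ob C \<and> x \<in> on_Ob FF X"
  by (simp add: concrete_graph_def)

lemma Arr_E: "Arr E = {lift f x | f x. f \<in> Arr C \<and> x \<in> on_Ob FF (Dom C f)}"
  by (simp add: concrete_graph_def lift_def)

lemma lift_Arr: "f \<in> Arr C \<Longrightarrow> x \<in> on_Ob FF (Dom C f) \<Longrightarrow> lift f x \<in> Arr E"
  by (auto simp: Arr_E)

text \<open>No membership of \<open>x\<close> is required: the restricted arrow has source
  \<open>{x}\<close> in every case, from which \<open>the_elem\<close> recovers
  \<open>x\<close>.\<close>

lemma Dom_lift [simp]: "Dom E (lift f x) = (Dom C f, x)"
  by (simp add: concrete_graph_def lift_def restrict_elem_def)

lemma Cod_lift [simp]: "Cod E (lift f x) = (Cod C f, act f x)"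
  by (simp add: concrete_graph_def lift_def restrict_elem_def)

text \<open>Here \<open>y\<close> is arbitrary, because composition recomputes the restriction from
  \<open>g \<cdot> f\<close> and the source element of the right factor.\<close>

lemma Comp_lift [simp]: "lift g y \<cdot>\<^bsub>E\<^esub> lift f x = lift (g \<cdot>\<^bsub>C\<^esub> f) x"
  by (simp add: concrete_graph_def lift_def restrict_elem_def)

lemma fst_Comp: "fst ((g, s) \<cdot>\<^bsub>E\<^esub> (f, r)) = g \<cdot>\<^bsub>C\<^esub> f"
  by (simp add: concrete_graph_def)

lemma Id_E: "X \<in> Ob C \<Longrightarrow> Id E (X, x) = lift (Id C X) x"
  by (simp add: concrete_graph_def lift_def on_Arr_Id)

text \<open>Reduces questions about arrows of \<open>E\<close> to arrows of \<open>C\<close> and an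
  equation between elements.\<close>

lemma Hom_E:
  "h \<in> Hom E (X, x) (Y, y) \<longleftrightarrow>
    (\<exists>f \<in> Hom C X Y. h = lift f x \<and> x \<in> on_Ob FF X \<and> act f x = y)"
  by (auto simp: Hom_def Arr_E)

lemma category_E: "category E"
proof
  fix f assume "f \<in> Arr E"
  then obtain u x where f: "f = lift u x" "u \<in> Arr C" "x \<in> on_Ob FF (Dom C u)"
    by (auto simp: Arr_E)
  then show "Dom E f \<in> Ob E"
    by (simp add: Ob_E source.Dom_Ob)
  from f show "Cod E f \<in> Ob E"
    using act_in[of u "Dom C u" "Cod C u" x] by (simp add: Ob_E source.Cod_Ob Hom_def)
next
  fix X assume "X \<in> Ob E"
  then show "Id E X \<in> Hom E X X"
    by (cases X) (auto simp: Ob_E Id_E Hom_E source.Id_Hom act_Id)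
next
  fix f g X Y Z assume "f \<in> Hom E X Y" "g \<in> Hom E Y Z"
  then show "g \<cdot>\<^bsub>E\<^esub> f \<in> Hom E X Z"
    by (cases X; cases Y; cases Z)
      (auto simp: Hom_E act_Comp intro!: bexI[OF _ source.Comp_Hom])
next
  fix f X Y assume "f \<in> Hom E X Y"
  then obtain u where u: "u \<in> Hom C (fst X) (fst Y)" "f = lift u (snd X)"
      "act u (snd X) = snd Y"
    by (cases X; cases Y) (auto simp: Hom_E)
  then have "fst X \<in> Ob C" "fst Y \<in> Ob C"
    using source.Dom_Ob[of u] source.Cod_Ob[of u] by (auto simp: Hom_def)
  then have "Id E X = lift (Id C (fst X)) (snd X)" "Id E Y = lift (Id C (fst Y)) (snd Y)"
    using Id_E by (metis prod.collapse)+
  with u show "f \<cdot>\<^bsub>E\<^esub> Id E X = f" "Id E Y \<cdot>\<^bsub>E\<^esub> f = f"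
    by (auto simp: source.Id_right source.Id_left)
next
  fix f g h W X Y Z assume "f \<in> Hom E W X" "g \<in> Hom E X Y" "h \<in> Hom E Y Z"
  then show "(h \<cdot>\<^bsub>E\<^esub> g) \<cdot>\<^bsub>E\<^esub> f = h \<cdot>\<^bsub>E\<^esub> (g \<cdot>\<^bsub>E\<^esub> f)"
    \<comment> \<open>Both sides are lifts at the source element of \<open>f\<close>, so
      associativity in \<open>C\<close> suffices.\<close>
    by (cases W; cases X; cases Y; cases Z) (auto simp: Hom_E source.Comp_assoc)
qed

lemma first_proj_functor: "covariant_functor E C first_proj"
proof -
  interpret E: category E by (rule category_E)
  show ?thesis
    by unfold_locales (auto simp: first_proj_def Ob_E Id_E Hom_E pair_eq_lift fst_Comp)
qed

lemma opCartesian_lift: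
  assumes u: "u \<in> Arr C" and x: "x \<in> on_Ob FF (Dom C u)"
  shows "opCartesian E C first_proj (lift u x) u"
  unfolding opCartesian_def
proof (intro conjI ballI impI)
  show "lift u x \<in> Arr E" using u x by (rule lift_Arr)
  show "on_Arr first_proj (lift u x) = u" by (simp add: first_proj_def)
next
  fix Z g w
  assume g: "g \<in> Hom E (Dom E (lift u x)) Z"
    and w: "w \<in> Hom C (Cod C u) (on_Ob first_proj Z)"
    and eq: "on_Arr first_proj g = w \<cdot>\<^bsub>C\<^esub> u"
  obtain Z1 z where Z: "Z = (Z1, z)" by (cases Z)
  have u': "u \<in> Hom C (Dom C u) (Cod C u)" using u by (simp add: Hom_def)
  have w': "w \<in> Hom C (Cod C u) Z1" using w by (simp add: Z first_proj_def)
  have g': "g = lift (w \<cdot>\<^bsub>C\<^esub> u) x" "act (w \<cdot>\<^bsub>C\<^esub> u) x = z"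
    using g eq by (auto simp: Z Hom_E first_proj_def)
  show "\<exists>!h. h \<in> Hom E (Cod E (lift u x)) Z \<and> on_Arr first_proj h = w
      \<and> h \<cdot>\<^bsub>E\<^esub> lift u x = g"
  \<comment> \<open>The factor must start at the target element \<open>act u x\<close> of
    \<open>lift u x\<close>; it ends at \<open>z\<close> because
    \<open>act w (act u x) = act (w \<cdot> u) x\<close>.\<close>
  proof (rule ex1I[of _ "lift w (act u x)"])
    show "lift w (act u x) \<in> Hom E (Cod E (lift u x)) Z
        \<and> on_Arr first_proj (lift w (act u x)) = w \<and> lift w (act u x) \<cdot>\<^bsub>E\<^esub> lift u x = g"
      using u' w' x g' act_Comp[OF u' w' x] act_in[OF u' x]
      by (auto simp: Z Hom_E first_proj_def)
  next
    fix h assume "h \<in> Hom E (Cod E (lift u x)) Z \<and> on_Arr first_proj h = w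
        \<and> h \<cdot>\<^bsub>E\<^esub> lift u x = g"
    \<comment> \<open>The domain of \<open>h\<close> fixes its source element and the projection
      fixes its first component.\<close>
    then show "h = lift w (act u x)"
      by (auto simp: Z Hom_E first_proj_def)
  qed
qed (fact u)

text \<open>The splitting laws are \<open>Id_E\<close> and \<open>Comp_lift\<close>: identities are
  lifts of identities, and composites of lifts are lifts of composites.\<close>

lemma split_opcleavage_lift: "split_opcleavage E C first_proj (\<lambda>u X. lift u (snd X))"
  unfolding split_opcleavage_def opcleavage_def
  by (auto simp: Ob_E lift_Arr Id_E first_proj_def opCartesian_lift[unfolded first_proj_def])

lemma split_opfibration_first_proj: "split_opfibration E C first_proj"
proof -
  \<comment> \<open>The opcleavage supplies the required opCartesian arrows.\<close>
  have "opfibration E C first_proj"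
    using first_proj_functor split_opcleavage_lift
    unfolding opfibration_def split_opcleavage_def opcleavage_def by meson
  then show ?thesis
    using split_opcleavage_lift unfolding split_opfibration_def by blast
qed

end

theorem proposition6:
  fixes C :: "('o, 'm) cat_data" and D :: "('p, 'n) cat_data"
    and F :: "('o, 'm, 'p, 'n) functor_data"
    and U :: "('p, 'n, 'u set, 'u set_arr) functor_data"
  assumes "covariant_functor C D F"
    and "faithful_functor D SetCat U"
  shows "split_opfibration (concrete_graph C (U \<circ>\<^sub>F F)) C first_proj"
proof -
  have "covariant_functor D SetCat U"
    using assms(2) by (simp add: faithful_functor_def)
  with assms(1) have "set_valued_functor C (U \<circ>\<^sub>F F)"
    by (simp add: set_valued_functor_def covariant_functor_comp)
  then show ?thesis
    by (rule set_valued_functor.split_opfibration_first_proj)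
qed

end
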